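(* Let $G$ be a $[4,2]$-graph of order $n$. Then $e(G)\ge \lfloor (n-1)^2/4\rfloor$. Moreover, if $n\ge 7$, equality holds if and only if $G$ is isomorphic to the disjoint union $K_{\lfloor n/2\rfloor}+K_{\lceil n/2\rceil}$ of two complete graphs.
   Context: All graphs are finite and simple. $e(G)$ denotes the number of edges of $G$. For a positive integer $s$ and a nonnegative integer $t$, a graph $G$ of order at least $s$ is called an $[s,t]$-graph if every induced subgraph of $G$ on $s$ vertices has at least $t$ edges. $K_m$ is the complete graph on $m$ vertices and $G+H$ denotes the vertex-disjoint union of $G$ and $H$. *)

theory Defs
  imports Complex_Main
begin

datatype 'a ugraph = Graph (verts: "'a set") (edges: "'a set set")

definition simple_graph :: "'a ugraph \<Rightarrow> bool" where
  "simple_graph G \<longleftrightarrow>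
     finite (verts G) \<and> (\<forall>e\<in>edges G. e \<subseteq> verts G \<and> card e = 2)"

definition order :: "'a ugraph \<Rightarrow> nat" where
  "order G = card (verts G)"

definition num_edges :: "'a ugraph \<Rightarrow> nat" where
  "num_edges G = card (edges G)"

definition induced_subgraph :: "'a ugraph \<Rightarrow> 'a set \<Rightarrow> 'a ugraph" where
  "induced_subgraph G S = Graph S {e \<in> edges G. e \<subseteq> S}"

definition st_graph :: "nat \<Rightarrow> nat \<Rightarrow> 'a ugraph \<Rightarrow> bool" where
  "st_graph s t G \<longleftrightarrow>
     simple_graph G \<and> order G \<ge> s \<and>
     (\<forall>S. S \<subseteq> verts G \<and> card S = s \<longrightarrow> num_edges (induced_subgraph G S) \<ge> t)"

definition complete_graph :: "nat \<Rightarrow> nat ugraph" where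
  "complete_graph m = Graph {..<m} {e. e \<subseteq> {..<m} \<and> card e = 2}"

definition disjoint_union :: "'a ugraph \<Rightarrow> 'b ugraph \<Rightarrow> ('a + 'b) ugraph" where
  "disjoint_union G H =
     Graph (verts G <+> verts H) ((`) Inl ` edges G \<union> (`) Inr ` edges H)"

definition graph_iso :: "'a ugraph \<Rightarrow> 'b ugraph \<Rightarrow> bool" where
  "graph_iso G H \<longleftrightarrow>
     (\<exists>f. bij_betw f (verts G) (verts H) \<and>
          (\<forall>u\<in>verts G. \<forall>v\<in>verts G. {u, v} \<in> edges G \<longleftrightarrow> {f u, f v} \<in> edges H))"

end

theory Submission
  imports Defs
begin

text \<open>
  In the complement of a \<open>[4,2]\<close>-graph no edge lies in two triangles. If the complement
  contains a triangle, every other vertex is adjacent to at most one of its vertices, so deleting the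
  triangle destroys at most \<open>n\<close> edges; by induction on the order this yields at most
  \<open>\<lfloor>n\<^sup>2 / 4\<rfloor>\<close> edges, and strictly fewer when \<open>n \<ge> 7\<close>. Otherwise let
  \<open>A\<close> be the neighbourhood of a vertex of maximum degree: \<open>A\<close> is independent, so every
  edge meets \<open>V - A\<close> and there are at most \<open>|A| (n - |A|)\<close> edges, with equality only for
  the complete bipartite graph with parts \<open>A\<close> and \<open>V - A\<close>.
\<close>

section \<open>Graphs as symmetric relations\<close>

text \<open>Edges are counted as ordered pairs, hence twice, so that their number is the degree sum.\<close>

definition book_free :: "('a \<times> 'a) set \<Rightarrow> bool" where
  "book_free R \<longleftrightarrow>
     (\<forall>a b c d. (a, b) \<in> R \<longrightarrow> (a, c) \<in> R \<longrightarrow> (b, c) \<in> R \<longrightarrow> (a, d) \<in> R \<longrightarrow> (b, d) \<in> R \<longrightarrow> c = d)"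

definition triangle_free :: "('a \<times> 'a) set \<Rightarrow> bool" where
  "triangle_free R \<longleftrightarrow> (\<forall>a b c. (a, b) \<in> R \<longrightarrow> (a, c) \<in> R \<longrightarrow> (b, c) \<notin> R)"

section \<open>Arithmetic of the balanced product\<close>

text \<open>This is the floor of \<open>n^2 / 4\<close>, the edge count of the balanced complete
  bipartite graph on \<open>n\<close> vertices.\<close>

definition half_product :: "nat \<Rightarrow> nat" where
  "half_product n = (n div 2) * (n - n div 2)"

lemma half_product_even [simp]: "half_product (2 * k) = k * k"
  and half_product_odd [simp]: "half_product (Suc (2 * k)) = k * (k + 1)"
  by (simp_all add: half_product_def)

lemma half_cases:
  fixes n :: nat
  obtains k where "n = 2 * k" | k where "n = Suc (2 * k)"
  by (metis evenE oddE Suc_eq_plus1)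

text \<open>With factors \<open>a\<close> and \<open>a + d\<close>, the balanced product exceeds
  \<open>a * (a + d)\<close> by exactly \<open>k * k\<close> if \<open>d = 2 * k\<close>, and by
  \<open>k * k + k\<close> if \<open>d = 2 * k + 1\<close>.\<close>

lemma product_le_half_product:
  fixes a b :: nat
  shows "a * b \<le> half_product (a + b)"
proof -
  have *: "a * (a + d) \<le> half_product (a + (a + d))" for a d :: nat
  proof (cases d rule: half_cases)
    case (1 k)
    then have "a + (a + d) = 2 * (a + k)" by simp
    then have "half_product (a + (a + d)) = (a + k) * (a + k)"
      by (simp only: half_product_even)
    then show ?thesis using 1 by (simp add: algebra_simps)
  next
    case (2 k)
    then have "a + (a + d) = Suc (2 * (a + k))" by simp
    then have "half_product (a + (a + d)) = (a + k) * (a + k + 1)"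
      by (simp only: half_product_odd)
    then show ?thesis using 2 by (simp add: algebra_simps)
  qed
  show ?thesis
  proof (cases "a \<le> b")
    case True
    then show ?thesis using *[of a "b - a"] by simp
  next
    case False
    then show ?thesis using *[of b "a - b"] by (simp add: mult.commute add.commute)
  qed
qed

text \<open>The excess of the balanced product, \<open>d * d\<close> or \<open>d * d + d\<close>,
  vanishes only for \<open>d = 0\<close>, so the factors differ by at most one.\<close>

lemma product_eq_half_product:
  fixes a b :: nat
  assumes "a * b = half_product (a + b)" "a \<le> b"
  shows "a = (a + b) div 2"
proof (cases "a + b" rule: half_cases)
  case (1 k)
  then have "a \<le> k" using assms(2) by linarith
  then obtain d where d: "k = a + d" by (auto simp: le_iff_add)
  then have b: "b = a + 2 * d" using 1 by simp
  have "a * (a + 2 * d) = (a + d) * (a + d)" using assms(1) 1 d by (metis b half_product_even)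
  then have "d * d = 0" by (simp add: algebra_simps)
  then show ?thesis using b by simp
next
  case (2 k)
  then have "a \<le> k" using assms(2) by linarith
  then obtain d where d: "k = a + d" by (auto simp: le_iff_add)
  then have b: "b = a + 2 * d + 1" using 2 by simp
  have "a * (a + 2 * d + 1) = (a + d) * (a + d + 1)" using assms(1) 2 d by (metis b half_product_odd)
  then have "d * d + d = 0" by (simp add: algebra_simps)
  then show ?thesis using b by simp
qed

text \<open>Deleting a triangle costs at most \<open>n\<close> edges, whereas the bound drops by
  \<open>3 * k - 2\<close> for \<open>n = 2 * k\<close> and by \<open>3 * k - 1\<close> for
  \<open>n = 2 * k + 1\<close>, which is more. The shift from \<open>k\<close> to \<open>j\<close>
  removes truncated subtraction.\<close>

lemma half_product_diff_3:
  assumes "n \<ge> 7"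
  shows "n + half_product (n - 3) < half_product n"
proof (cases n rule: half_cases)
  case (1 k)
  then have "k \<ge> 4" using assms by linarith
  then obtain j where j: "k = j + 4" by (metis add.commute le_iff_add)
  have "n - 3 = Suc (2 * (j + 2))" using 1 j by simp
  then have "half_product (n - 3) = (j + 2) * (j + 2 + 1)" by (simp only: half_product_odd)
  moreover have "half_product n = (j + 4) * (j + 4)" using 1 j by (simp only: half_product_even)
  ultimately show ?thesis using 1 j by (simp add: algebra_simps)
next
  case (2 k)
  then have "k \<ge> 3" using assms by linarith
  then obtain j where j: "k = j + 3" by (metis add.commute le_iff_add)
  have "n - 3 = 2 * (j + 2)" using 2 j by simp
  then have "half_product (n - 3) = (j + 2) * (j + 2)" by (simp only: half_product_even)
  moreover have "half_product n = (j + 3) * (j + 3 + 1)" using 2 j by (simp only: half_product_odd)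
  ultimately show ?thesis using 2 j by (simp add: algebra_simps)
qed

section \<open>Extremal bounds for book-free and triangle-free relations\<close>

lemma card_relation_le:
  assumes "finite V" "R \<subseteq> V \<times> V" "irrefl R"
  shows "card R \<le> card V * (card V - 1)"
proof -
  have "R \<subseteq> V \<times> V - (\<lambda>x. (x, x)) ` V" using assms by (auto simp: irrefl_def)
  then have "card R \<le> card (V \<times> V - (\<lambda>x. (x, x)) ` V)"
    using assms(1) by (intro card_mono) auto
  also have "\<dots> = card V * card V - card V"
    using assms(1) by (subst card_Diff_subset) (auto simp: card_image inj_on_def card_cartesian_product)
  finally show ?thesis by (simp add: diff_mult_distrib2)
qed

text \<open>A vertex outside \<open>T\<close> with two neighbours in \<open>T\<close> would put an
  edge of \<open>T\<close> into a second triangle. Hence at most \<open>card V - 3\<close> edges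
  leave \<open>T\<close>, and three lie inside it.\<close>

lemma card_delete_triangle:
  assumes "finite V" "R \<subseteq> V \<times> V" "sym R" "irrefl R" "book_free R"
    and xyz: "(x, y) \<in> R" "(x, z) \<in> R" "(y, z) \<in> R"
  defines "T \<equiv> {x, y, z}"
  shows "card R \<le> 2 * card V + card (R \<inter> (V - T) \<times> (V - T))" and "card (V - T) = card V - 3"
    and "card V \<ge> 3"
proof -
  have TV: "T \<subseteq> V" using xyz assms(2) by (auto simp: T_def)
  have fR: "finite R" using assms(1,2) by (meson finite_SigmaI finite_subset)
  have ne: "x \<noteq> y" "x \<noteq> z" "y \<noteq> z" using xyz assms(4) by (auto simp: irrefl_def)
  then have cT: "card T = 3" by (simp add: T_def)
  have fT: "finite T" by (simp add: T_def)
  show cVT: "card (V - T) = card V - 3" using TV fT cT by (simp add: card_Diff_subset)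
  show cV: "card V \<ge> 3" using TV cT assms(1) card_mono by metis
  define P where "P = R \<inter> (V - T) \<times> T"
  \<comment> \<open>Injectivity of \<open>fst\<close> says that each outside vertex has at most one
    neighbour in \<open>T\<close>.\<close>
  have "inj_on fst P"
  proof (rule inj_onI)
    fix p q assume p: "p \<in> P" and q: "q \<in> P" and eq: "fst p = fst q"
    obtain w s where ws: "p = (w, s)" by (cases p)
    obtain t where wt: "q = (w, t)" using eq ws by (cases q) auto
    have s: "(s, w) \<in> R" "s \<in> T" "w \<notin> T" and t: "(t, w) \<in> R" "t \<in> T"
      using p q ws wt assms(3) by (auto simp: P_def sym_def)
    have "s = t"
    proof (rule ccontr)
      assume "s \<noteq> t"
      \<comment> \<open>The third vertex \<open>u\<close> of the triangle and the outside vertex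
        \<open>w\<close> would both be common neighbours of \<open>s\<close> and
        \<open>t\<close>.\<close>
      then obtain u where u: "u \<in> T" "(s, u) \<in> R" "(t, u) \<in> R" "(s, t) \<in> R"
        using s(2) t(2) xyz assms(3) ne unfolding T_def sym_def
        by (elim insertE emptyE; simp; metis)
      then have "u = w" using assms(5) s t unfolding book_free_def by blast
      then show False using u(1) s(3) by simp
    qed
    then show "p = q" using ws wt by simp
  qed
  then have cP: "card P \<le> card (V - T)"
    using assms(1) by (intro card_inj_on_le[where f = fst]) (auto simp: P_def)
  have cT': "card (R \<inter> T \<times> T) \<le> 6"
    using card_relation_le[OF fT, of "R \<inter> T \<times> T"] cT assms(4) by (auto simp: irrefl_def)
  define Q where "Q = R \<inter> (V - T) \<times> (V - T)"
  have "R \<subseteq> P \<union> P\<inverse> \<union> (R \<inter> T \<times> T) \<union> Q"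
    using assms(2,3) by (auto simp: P_def Q_def sym_def)
  moreover have "finite (P \<union> P\<inverse> \<union> (R \<inter> T \<times> T) \<union> Q)" using fR by (simp add: P_def Q_def)
  ultimately have "card R \<le> card (P \<union> P\<inverse> \<union> (R \<inter> T \<times> T) \<union> Q)" by (meson card_mono)
  also have "\<dots> \<le> card P + card (P\<inverse>) + card (R \<inter> T \<times> T) + card Q"
    by (meson card_Un_le add_mono order_trans order_refl)
  \<comment> \<open>The count is \<open>(card V - 3) + (card V - 3) + 6\<close>; \<open>cV\<close>
    keeps the subtraction from truncating.\<close>
  also have "\<dots> \<le> 2 * card V + card Q"
    using cP cT' cVT cV by (simp add: card_inverse)
  finally show "card R \<le> 2 * card V + card (R \<inter> (V - T) \<times> (V - T))" by (simp add: Q_def)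
qed

text \<open>Mantel's theorem with its extremal case. The product of the part sizes is kept in the
  conclusion because it later determines those sizes.\<close>

lemma mantel:
  assumes "finite V" "R \<subseteq> V \<times> V" "sym R" "triangle_free R" "V \<noteq> {}"
  shows "card R \<le> 2 * half_product (card V)"
    and "card R = 2 * half_product (card V) \<Longrightarrow>
      \<exists>A\<subseteq>V. R = A \<times> (V - A) \<union> (V - A) \<times> A \<and> card A * card (V - A) = half_product (card V)"
proof -
  define d where "d w = card (R `` {w})" for w
  have fR: "finite R" using assms(1,2) by (meson finite_SigmaI finite_subset)
  have "Max (d ` V) \<in> d ` V" using assms by (intro Max_in) auto
  then obtain v where v: "v \<in> V" "d v = Max (d ` V)" by auto
  have dmax: "d w \<le> d v" if "w \<in> V" for w using that v assms(1) by simp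
  define A where "A = R `` {v}"
  define B where "B = V - A"
  have AV: "A \<subseteq> V" using assms(2) by (auto simp: A_def)
  have fA: "finite A" and fB: "finite B" using AV assms(1) by (auto simp: B_def finite_subset)
  have cAB: "card A + card B = card V"
    using AV assms(1) fA by (simp add: B_def card_Diff_subset card_mono)
  have indep: "(s, t) \<notin> R" if "s \<in> A" "t \<in> A" for s t
    using that assms(4) unfolding A_def triangle_free_def by blast
  define P where "P = R \<inter> B \<times> V"
  have P_sigma: "P = Sigma B (\<lambda>w. R `` {w})" using assms(2) by (auto simp: P_def)
  have "card P = (\<Sum>w\<in>B. d w)"
    unfolding P_sigma d_def using fB fR by (simp add: card_SigmaI finite_Image)
  also have "\<dots> \<le> card B * card A"
    using sum_bounded_above[of B d "card A"] dmax by (simp add: A_def B_def d_def)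
  finally have cP: "card P \<le> card A * card B" by (simp add: mult.commute)
  \<comment> \<open>Since \<open>A\<close> is independent, every pair has an end in
    \<open>B\<close>. The overlap of \<open>P\<close> and its converse consists of the pairs inside
    \<open>B\<close>, which the next count takes twice.\<close>
  have RP: "R = P \<union> P\<inverse>" using assms(2,3) indep by (auto simp: P_def B_def sym_def)
  have fP: "finite P" using fR by (simp add: P_def)
  have cR: "card R + card (P \<inter> P\<inverse>) = 2 * card P"
    using card_Un_Int[of P "P\<inverse>"] fP by (simp add: RP[symmetric] card_inverse)
  have prod: "card A * card B \<le> half_product (card V)"
    using product_le_half_product cAB by metis
  show "card R \<le> 2 * half_product (card V)" using cR cP prod by linarith
  assume eq: "card R = 2 * half_product (card V)"
  \<comment> \<open>Equality leaves no slack in any of the three estimates: no edge lies inside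
    \<open>B\<close>, \<open>P\<close> has the size of \<open>B \<times> A\<close>, and the parts
    are balanced.\<close>
  then have "card (P \<inter> P\<inverse>) = 0" and cP': "card P = card A * card B"
    and cab: "card A * card B = half_product (card V)"
    using cR cP prod by linarith+
  then have disj: "P \<inter> P\<inverse> = {}" using fP by simp
  have "P \<subseteq> B \<times> A"
  proof
    fix p assume "p \<in> P"
    then obtain s t where p: "p = (s, t)" "(s, t) \<in> P" by (cases p) auto
    then have "(s, t) \<in> R" "s \<in> B" "t \<in> V" by (auto simp: P_def)
    moreover have "t \<notin> B"
    proof
      assume "t \<in> B"
      then have "(t, s) \<in> P" using p assms(3) by (auto simp: P_def sym_def B_def)
      then show False using disj p by auto
    qed
    ultimately show "p \<in> B \<times> A" using p by (simp add: B_def)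
  qed
  then have "P = B \<times> A"
    using cP' fA fB by (intro card_subset_eq) (simp_all add: card_cartesian_product mult.commute)
  then have "R = A \<times> (V - A) \<union> (V - A) \<times> A" using RP by (auto simp: B_def)
  then show "\<exists>A\<subseteq>V. R = A \<times> (V - A) \<union> (V - A) \<times> A \<and> card A * card (V - A) = half_product (card V)"
    using AV cab unfolding B_def by blast
qed

text \<open>The bound fails for a triangle on three vertices, so the induction may only descend to
  sets of at least four vertices. This is why strictness starts at 7; it reduces the extremal case
  to triangle-free relations.\<close>

lemma card_book_free_le:
  assumes "finite V" "R \<subseteq> V \<times> V" "sym R" "irrefl R" "book_free R" "card V \<ge> 4"
  shows "card R \<le> 2 * half_product (card V) \<and>
    (card V \<ge> 7 \<longrightarrow> \<not> triangle_free R \<longrightarrow> card R < 2 * half_product (card V))"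
  using assms
proof (induction "card V" arbitrary: V R rule: less_induct)
  case less
  have tri: "card R \<le> 2 * half_product (card V) \<and> (card V \<ge> 7 \<longrightarrow> card R < 2 * half_product (card V))"
    if ntf: "\<not> triangle_free R"
  proof -
    obtain x y z where xyz: "(x, y) \<in> R" "(x, z) \<in> R" "(y, z) \<in> R"
      using ntf by (auto simp: triangle_free_def)
    define W where "W = V - {x, y, z}"
    define Q where "Q = R \<inter> W \<times> W"
    note del = card_delete_triangle[OF less.prems(1-5) xyz, folded W_def, folded Q_def]
    have Q: "finite W" "Q \<subseteq> W \<times> W" "sym Q" "irrefl Q" "book_free Q"
      using less.prems(1-5) by (auto simp: W_def Q_def sym_def irrefl_def book_free_def)
    show ?thesis
    proof (cases "card V \<ge> 7")
      case True
      then have "card W < card V" "card W \<ge> 4" using del(2) by linarith+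
      then have "card Q \<le> 2 * half_product (card V - 3)"
        using less.hyps[OF _ Q] del(2) by simp
      then show ?thesis using half_product_diff_3[OF True] del(1) by linarith
    next
      case False
      \<comment> \<open>The one, two or three remaining vertices carry at most 0, 2 or 6 ordered
        pairs. The totals 8, 12 and 18 are exactly twice \<open>half_product\<close>, so strictness
        cannot be read off here.\<close>
      then have "card V \<in> {4, 5, 6}" using less.prems(6) by auto
      then show ?thesis
        using card_relation_le[OF Q(1,2,4)] del by (auto simp: half_product_def)
    qed
  qed
  have ne: "V \<noteq> {}" using less.prems(6) by auto
  show ?case using tri mantel(1)[OF less.prems(1-3) _ ne] by blast
qed

section \<open>The complement of a graph\<close>

definition nonadjacency :: "'a ugraph \<Rightarrow> ('a \<times> 'a) set" where
  "nonadjacency G = {(u, v). u \<in> verts G \<and> v \<in> verts G \<and> u \<noteq> v \<and> {u, v} \<notin> edges G}"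

lemma card_ordered_pairs:
  assumes "finite E" "\<And>e. e \<in> E \<Longrightarrow> card e = 2"
  shows "card {(u, v). {u, v} \<in> E} = 2 * card E"
proof -
  have two: "card {(u, v). {u, v} = e} = 2 \<and> finite {(u, v). {u, v} = e}" if "e \<in> E" for e
  proof -
    have "card e = 2" using assms(2) that by blast
    then obtain x y where e: "e = {x, y}" "x \<noteq> y" by (auto simp: card_2_iff)
    then have "{(u, v). {u, v} = e} = {(x, y), (y, x)}" by (auto simp: doubleton_eq_iff)
    then show ?thesis using e by simp
  qed
  have "{(u, v). {u, v} \<in> E} = (\<Union>e\<in>E. {(u, v). {u, v} = e})" by auto
  then have "card {(u, v). {u, v} \<in> E} = (\<Sum>e\<in>E. card {(u, v). {u, v} = e})"
    using assms(1) two by (simp only:) (subst card_UN_disjoint; auto)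
  then show ?thesis using two by simp
qed

lemma card_ordered_edges:
  assumes "simple_graph G"
  shows "card {(u, v). {u, v} \<in> edges G} = 2 * num_edges G"
proof -
  have "edges G \<subseteq> Pow (verts G)" "finite (verts G)" using assms by (auto simp: simple_graph_def)
  then have "finite (edges G)" by (meson finite_Pow_iff finite_subset)
  then show ?thesis
    using assms card_ordered_pairs[of "edges G"] by (auto simp: simple_graph_def num_edges_def)
qed

text \<open>Off the diagonal, each ordered pair of vertices is either an edge, counted twice in this
  way, or a non-edge.\<close>

lemma card_nonadjacency:
  assumes "simple_graph G"
  shows "2 * num_edges G + card (nonadjacency G) = order G * (order G - 1)"
proof -
  let ?V = "verts G"
  let ?D = "{(u, v). {u, v} \<in> edges G}"
  have fV: "finite ?V" and E: "\<And>e. e \<in> edges G \<Longrightarrow> e \<subseteq> ?V \<and> card e = 2"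
    using assms by (auto simp: simple_graph_def)
  have DV: "?D \<subseteq> ?V \<times> ?V" using E by auto
  have irr: "{u, u} \<notin> edges G" for u using E[of "{u, u}"] by auto
  have "?D \<union> nonadjacency G = ?V \<times> ?V - (\<lambda>x. (x, x)) ` ?V"
    using DV irr by (auto simp: nonadjacency_def)
  moreover have "card (?V \<times> ?V - (\<lambda>x. (x, x)) ` ?V) = card ?V * (card ?V - 1)"
    using fV by (subst card_Diff_subset)
      (auto simp: card_image inj_on_def card_cartesian_product diff_mult_distrib2)
  moreover have "card (?D \<union> nonadjacency G) = card ?D + card (nonadjacency G)"
  proof (rule card_Un_disjoint)
    show "finite ?D" using DV fV by (meson finite_SigmaI finite_subset)
    show "finite (nonadjacency G)"
      by (rule finite_subset[of _ "?V \<times> ?V"]) (use fV in \<open>auto simp: nonadjacency_def\<close>)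
  qed (auto simp: nonadjacency_def)
  ultimately show ?thesis
    using card_ordered_edges[OF assms] by (simp add: order_def)
qed

text \<open>Two triangles on a common edge of the complement occupy five of the six pairs of a
  4-set, which leaves \<open>G\<close> at most one edge there instead of two.\<close>

lemma book_free_nonadjacency:
  assumes "st_graph 4 2 G"
  shows "book_free (nonadjacency G)"
  unfolding book_free_def
proof (intro allI impI, rule ccontr)
  fix a b c d
  assume R: "(a, b) \<in> nonadjacency G" "(a, c) \<in> nonadjacency G" "(b, c) \<in> nonadjacency G"
    "(a, d) \<in> nonadjacency G" "(b, d) \<in> nonadjacency G" and "c \<noteq> d"
  let ?S = "{a, b, c, d}"
  have S: "?S \<subseteq> verts G" "card ?S = 4" using R \<open>c \<noteq> d\<close> by (auto simp: nonadjacency_def)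
  have "e = {c, d}" if e: "e \<in> edges G" "e \<subseteq> ?S" for e
  proof -
    have "card e = 2" using e assms by (auto simp: st_graph_def simple_graph_def)
    then obtain u v where uv: "e = {u, v}" "u \<noteq> v" by (auto simp: card_2_iff)
    then have "u \<in> ?S" "v \<in> ?S" using e(2) by auto
    then show ?thesis using uv e(1) R unfolding nonadjacency_def
      by (auto simp: insert_commute)
  qed
  then have "edges (induced_subgraph G ?S) \<subseteq> {{c, d}}" by (auto simp: induced_subgraph_def)
  then have "num_edges (induced_subgraph G ?S) \<le> card {{c, d}}"
    unfolding num_edges_def by (intro card_mono) auto
  moreover have "num_edges (induced_subgraph G ?S) \<ge> 2"
    using assms S unfolding st_graph_def by blast
  ultimately show False by simp
qed

text \<open>The claimed bound is the number of vertex pairs minus the largest possible number of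
  non-edges.\<close>

lemma floor_square_quarter:
  "\<lfloor>(real n - 1)\<^sup>2 / 4\<rfloor> = int (n * (n - 1) div 2) - int (half_product n)"
proof (cases n rule: half_cases)
  case (1 k)
  show ?thesis
  proof (cases k)
    \<comment> \<open>For \<open>n = 0\<close> the real \<open>n - 1\<close> is -1 while the natural
      one truncates to 0; both sides still equal 0.\<close>
    case 0
    then show ?thesis using 1 by (simp add: floor_eq_iff half_product_def)
  next
    case (Suc j)
    then have "n * (n - 1) div 2 = (j + 1) * (2 * j + 1)" using 1 by simp
    moreover have "\<lfloor>(real n - 1)\<^sup>2 / 4\<rfloor> = int ((j + 1) * j)"
      using 1 Suc by (intro floor_unique) (simp_all add: power2_eq_square field_simps)
    moreover have "half_product n = (j + 1) * (j + 1)"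
      using 1 Suc by (metis Suc_eq_plus1 half_product_even)
    ultimately show ?thesis by (simp add: algebra_simps)
  qed
next
  case (2 k)
  then have "n * (n - 1) div 2 = k * (2 * k + 1)" by simp
  moreover have "\<lfloor>(real n - 1)\<^sup>2 / 4\<rfloor> = int (k * k)"
    using 2 by (intro floor_unique) (simp_all add: power2_eq_square field_simps)
  moreover have "half_product n = k * (k + 1)" using 2 by (simp only: half_product_odd)
  ultimately show ?thesis by (simp add: algebra_simps)
qed

section \<open>Disjoint unions of two complete graphs\<close>

lemma nat_floor_half: "nat \<lfloor>real n / 2\<rfloor> = n div 2"
  using floor_divide_of_nat_eq[of n 2, where 'a = real] by simp

lemma nat_ceiling_half: "nat \<lceil>real n / 2\<rceil> = n - n div 2"
proof (cases n rule: half_cases)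
  case (2 k)
  then have "\<lceil>real n / 2\<rceil> = int (k + 1)" by (intro ceiling_unique) (simp_all add: field_simps)
  then show ?thesis using 2 by simp
qed simp

lemma simple_disjoint_union_complete:
  "simple_graph (disjoint_union (complete_graph a) (complete_graph b))"
  by (auto simp: simple_graph_def disjoint_union_def complete_graph_def card_image)

text \<open>As \<open>graph_iso\<close> speaks of vertex pairs, the comparison is made on ordered
  pairs, where \<open>map_prod f f\<close> is a bijection between the doubled edge sets.\<close>

lemma graph_iso_num_edges:
  assumes "simple_graph G" "simple_graph H" "graph_iso G H"
  shows "num_edges G = num_edges H"
proof -
  obtain f where f: "bij_betw f (verts G) (verts H)"
    "\<And>u v. u \<in> verts G \<Longrightarrow> v \<in> verts G \<Longrightarrow> {u, v} \<in> edges G \<longleftrightarrow> {f u, f v} \<in> edges H"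
    using assms(3) unfolding graph_iso_def by blast
  have V: "{(u, v). {u, v} \<in> edges G} \<subseteq> verts G \<times> verts G"
    "{(u, v). {u, v} \<in> edges H} \<subseteq> verts H \<times> verts H"
    using assms(1,2) by (auto simp: simple_graph_def)
  have "bij_betw (map_prod f f) {(u, v). {u, v} \<in> edges G} {(u, v). {u, v} \<in> edges H}"
    unfolding bij_betw_def
  proof
    have "inj_on (map_prod f f) (verts G \<times> verts G)"
      using f(1) by (auto simp: bij_betw_def intro: map_prod_inj_on)
    then show "inj_on (map_prod f f) {(u, v). {u, v} \<in> edges G}" using V(1) by (rule inj_on_subset)
    show "map_prod f f ` {(u, v). {u, v} \<in> edges G} = {(u, v). {u, v} \<in> edges H}" (is "?L = ?R")
    proof
      show "?L \<subseteq> ?R" using V(1) f(2) by auto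
      show "?R \<subseteq> ?L"
      proof
        fix p assume p: "p \<in> ?R"
        then obtain s t where st: "p = (s, t)" "{s, t} \<in> edges H" by auto
        then have "s \<in> verts H" "t \<in> verts H" using V(2) by auto
        then obtain u v where "u \<in> verts G" "v \<in> verts G" "s = f u" "t = f v"
          using bij_betw_imp_surj_on[OF f(1)] by (metis imageE)
        then show "p \<in> ?L" using st f(2) by force
      qed
    qed
  qed
  then show ?thesis
    using assms(1,2) bij_betw_same_card card_ordered_edges
    by (metis nat_mult_eq_cancel1 zero_less_numeral)
qed

text \<open>The complement of \<open>K_a + K_b\<close> is complete bipartite, the shape delivered by
  \<open>mantel\<close>.\<close>

lemma nonadjacency_disjoint_union_complete:
  "nonadjacency (disjoint_union (complete_graph a) (complete_graph b)) =
     (Inl ` {..<a}) \<times> (Inr ` {..<b}) \<union> (Inr ` {..<b}) \<times> (Inl ` {..<a})"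
proof -
  let ?H = "disjoint_union (complete_graph a) (complete_graph b)"
  have V: "Inl i \<in> verts ?H \<longleftrightarrow> i < a" "Inr j \<in> verts ?H \<longleftrightarrow> j < b" for i j
    by (auto simp: disjoint_union_def complete_graph_def)
  have l: "{Inl i, Inl j} \<in> edges ?H" if "i < a" "j < a" "i \<noteq> j" for i j
    using that by (auto simp: disjoint_union_def complete_graph_def
        intro!: UnI1 image_eqI[where x = "{i, j}"])
  have r: "{Inr i, Inr j} \<in> edges ?H" if "i < b" "j < b" "i \<noteq> j" for i j
    using that by (auto simp: disjoint_union_def complete_graph_def
        intro!: UnI2 image_eqI[where x = "{i, j}"])
  have lr: "{Inl i, Inr j} \<notin> edges ?H" "{Inr j, Inl i} \<notin> edges ?H" for i j
    by (auto simp: disjoint_union_def)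
  have "(p, q) \<in> nonadjacency ?H \<longleftrightarrow>
    (p, q) \<in> (Inl ` {..<a}) \<times> (Inr ` {..<b}) \<union> (Inr ` {..<b}) \<times> (Inl ` {..<a})" for p q
    by (cases p; cases q) (use l r lr in \<open>auto simp: nonadjacency_def V\<close>)
  then show ?thesis by auto
qed

lemma num_edges_disjoint_union_complete:
  "2 * num_edges (disjoint_union (complete_graph a) (complete_graph b)) + 2 * (a * b) =
     (a + b) * (a + b - 1)"
proof -
  let ?H = "disjoint_union (complete_graph a) (complete_graph b)"
  let ?A = "Inl ` {..<a} :: (nat + nat) set" and ?B = "Inr ` {..<b} :: (nat + nat) set"
  have "order ?H = a + b" by (simp add: order_def disjoint_union_def complete_graph_def card_Plus)
  moreover have "card (nonadjacency ?H) = card (?A \<times> ?B) + card (?B \<times> ?A)"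
    unfolding nonadjacency_disjoint_union_complete by (intro card_Un_disjoint) auto
  then have "card (nonadjacency ?H) = 2 * (a * b)" by (simp add: card_cartesian_product card_image)
  ultimately show ?thesis
    using card_nonadjacency[OF simple_disjoint_union_complete, of a b] by simp
qed

text \<open>In both graphs two distinct vertices are adjacent exactly when they lie in the same
  part, so any bijections between corresponding parts glue to an isomorphism.\<close>

lemma graph_iso_disjoint_union_complete:
  assumes "simple_graph G" "A \<subseteq> verts G" "card A = a" "card (verts G - A) = b"
    and R: "nonadjacency G = A \<times> (verts G - A) \<union> (verts G - A) \<times> A"
  shows "graph_iso G (disjoint_union (complete_graph a) (complete_graph b))"
proof -
  let ?V = "verts G"
  let ?H = "disjoint_union (complete_graph a) (complete_graph b)"
  have fV: "finite ?V" using assms(1) by (simp add: simple_graph_def)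
  obtain g where g: "bij_betw g A {..<a}"
    using assms(2,3) fV by (metis bij_betw_iff_card card_lessThan finite_lessThan finite_subset)
  obtain h where h: "bij_betw h (?V - A) {..<b}"
    using assms(4) fV by (metis bij_betw_iff_card card_lessThan finite_lessThan finite_Diff)
  define f where "f x = (if x \<in> A then Inl (g x) else Inr (h x))" for x
  have VH: "verts ?H = Inl ` {..<a} \<union> Inr ` {..<b}"
    by (auto simp: disjoint_union_def complete_graph_def)
  have "bij_betw f (A \<union> (?V - A)) (Inl ` {..<a} \<union> Inr ` {..<b})"
  proof (rule bij_betw_combine)
    show "bij_betw f A (Inl ` {..<a})"
      using g by (auto simp: bij_betw_def f_def inj_on_def image_def)
    show "bij_betw f (?V - A) (Inr ` {..<b})"
      using h by (auto simp: bij_betw_def f_def inj_on_def image_def)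
  qed auto
  then have bij: "bij_betw f ?V (verts ?H)" using assms(2) VH by (simp add: Un_absorb1)
  have fA: "f u \<in> Inl ` {..<a}" if "u \<in> A" for u
    using that g by (auto simp: f_def bij_betw_def)
  have fB: "f u \<in> Inr ` {..<b}" if "u \<in> ?V - A" for u
    using that h by (auto simp: f_def bij_betw_def)
  \<comment> \<open>\<open>graph_iso\<close> also quantifies over \<open>u = v\<close>, where
    \<open>{u, v}\<close> collapses to a singleton.\<close>
  have loop: "{u} \<notin> edges G" "{w} \<notin> edges ?H" for u w
    using assms(1) simple_disjoint_union_complete[of a b] by (auto simp: simple_graph_def)
  have "{u, v} \<in> edges G \<longleftrightarrow> {f u, f v} \<in> edges ?H" if uv: "u \<in> ?V" "v \<in> ?V" for u v
  proof (cases "u = v")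
    case True
    then show ?thesis using loop by simp
  next
    case False
    then have ne: "f u \<noteq> f v" and fV': "f u \<in> verts ?H" "f v \<in> verts ?H"
      using bij uv by (auto simp: bij_betw_def inj_on_def)
    have "{u, v} \<notin> edges G \<longleftrightarrow> (u, v) \<in> nonadjacency G"
      using False uv by (simp add: nonadjacency_def)
    also have "\<dots> \<longleftrightarrow> (u \<in> A) \<noteq> (v \<in> A)" using R uv by auto
    also have "\<dots> \<longleftrightarrow> (f u, f v) \<in> nonadjacency ?H"
      unfolding nonadjacency_disjoint_union_complete using fA[of u] fA[of v] fB[of u] fB[of v] uv
      by (cases "u \<in> A"; cases "v \<in> A") auto
    also have "\<dots> \<longleftrightarrow> {f u, f v} \<notin> edges ?H" using ne fV' by (simp add: nonadjacency_def)
    finally show ?thesis by blast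
  qed
  then show ?thesis using bij unfolding graph_iso_def by blast
qed

section \<open>From non-edges of the complement bound to edges of the graph\<close>

theorem theorem9:
  fixes G :: "'a ugraph" and n :: nat
  assumes "st_graph 4 2 G" and "order G = n"
  shows "int (num_edges G) \<ge> \<lfloor>(real n - 1)\<^sup>2 / 4\<rfloor> \<and>
    (n \<ge> 7 \<longrightarrow>
      (int (num_edges G) = \<lfloor>(real n - 1)\<^sup>2 / 4\<rfloor> \<longleftrightarrow>
       graph_iso G
         (disjoint_union (complete_graph (nat \<lfloor>real n / 2\<rfloor>))
                         (complete_graph (nat \<lceil>real n / 2\<rceil>)))))"
proof -
  let ?V = "verts G" and ?R = "nonadjacency G"
  let ?H = "disjoint_union (complete_graph (n div 2)) (complete_graph (n - n div 2))"
  have G: "simple_graph G" and n4: "card ?V \<ge> 4" and n: "card ?V = n"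
    using assms by (auto simp: st_graph_def order_def)
  have R: "finite ?V" "?R \<subseteq> ?V \<times> ?V" "sym ?R" "irrefl ?R"
    using G by (auto simp: simple_graph_def nonadjacency_def sym_def irrefl_def insert_commute)
  note bound = card_book_free_le[OF R book_free_nonadjacency[OF assms(1)] n4, unfolded n]
  have count: "2 * num_edges G + card ?R = n * (n - 1)"
    using card_nonadjacency[OF G] assms(2) by simp
  \<comment> \<open>Evenness of \<open>n * (n - 1)\<close> makes the halving in
    \<open>floor_square_quarter\<close> exact.\<close>
  have ev: "2 * (n * (n - 1) div 2) = n * (n - 1)" by (cases n) simp_all
  have lower: "int (num_edges G) \<ge> \<lfloor>(real n - 1)\<^sup>2 / 4\<rfloor>"
    unfolding floor_square_quarter using bound count ev by linarith
  have eq: "int (num_edges G) = \<lfloor>(real n - 1)\<^sup>2 / 4\<rfloor> \<longleftrightarrow> card ?R = 2 * half_product n"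
    unfolding floor_square_quarter using count ev by linarith
  have "card ?R = 2 * half_product n \<longleftrightarrow> graph_iso G ?H" if n7: "n \<ge> 7"
  proof
    assume "graph_iso G ?H"
    then have "num_edges G = num_edges ?H"
      using graph_iso_num_edges[OF G simple_disjoint_union_complete] by blast
    then show "card ?R = 2 * half_product n"
      using num_edges_disjoint_union_complete[of "n div 2" "n - n div 2"] count
      by (simp add: half_product_def)
  next
    assume e: "card ?R = 2 * half_product n"
    \<comment> \<open>A triangle in the complement would make the bound strict.\<close>
    then have "triangle_free ?R" using bound n7 by (metis less_irrefl)
    moreover have "?V \<noteq> {}" using n4 by auto
    ultimately obtain A where A: "A \<subseteq> ?V" "?R = A \<times> (?V - A) \<union> (?V - A) \<times> A"
      "card A * card (?V - A) = half_product n"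
      using mantel(2)[OF R(1-3)] e n by metis
    \<comment> \<open>\<open>mantel\<close> does not say which part is smaller, but the first
      summand of \<open>?H\<close> has the smaller size \<open>n div 2\<close>. The situation is
      symmetric in \<open>A\<close> and its complement, so the smaller part can be taken as
      \<open>C\<close>.\<close>
    have wlog: "graph_iso G ?H"
      if C: "C \<subseteq> ?V" "?R = C \<times> (?V - C) \<union> (?V - C) \<times> C"
        "card C * card (?V - C) = half_product n" "card C \<le> card (?V - C)" for C
    proof -
      have "card C + card (?V - C) = n"
        using C(1) R(1) n by (metis card_Diff_subset card_mono finite_subset le_add_diff_inverse)
      then have "card C = n div 2" "card (?V - C) = n - n div 2"
        using product_eq_half_product[of "card C" "card (?V - C)"] C(3,4) by simp_all
      then show ?thesis using graph_iso_disjoint_union_complete[OF G C(1) _ _ C(2)] by blast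
    qed
    show "graph_iso G ?H"
    proof (cases "card A \<le> card (?V - A)")
      case True
      then show ?thesis using wlog[of A] A by blast
    next
      case False
      moreover have "?V - (?V - A) = A" using A(1) by auto
      ultimately show ?thesis using wlog[of "?V - A"] A by (auto simp: Un_commute mult.commute)
    qed
  qed
  then show ?thesis using lower eq unfolding nat_floor_half nat_ceiling_half by blast
qed

end
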